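(* Let $C,D\in GL(\mathcal{H})$ be self-adjoint operators. Let $F,G:\Omega\to\mathcal{H}$ be a $C$-controlled and a $D$-controlled continuous frame, respectively, and let $m:\Omega\to\mathbb{C}$ be a measurable function such that $\mathbf{M}_{m,F,G}$ is well defined. Let $\mathbb{M}$ be the multiplier of these controlled frames with respect to $m$, i.e. the operator weakly defined by \[ \langle\mathbb{M}f,g\rangle=\int_\Omega m(\omega)\langle f,CF(\omega)\rangle\langle DG(\omega),g\rangle\,d\mu(\omega)\qquad(f,g\in\mathcal{H}). \] Then $D^{-1}\,\mathbb{M}\,C^{-1}=\mathbf{M}_{m,F,G}$.
   Context: $\mathcal{H}$ is a complex Hilbert space with inner product linear in the first and conjugate linear in the second variable, and $(\Omega,\mu)$ is a measure space with positive measure $\mu$. $GL(\mathcal{H})$ is the set of bounded linear operators on $\mathcal{H}$ with bounded inverse. For $C\in GL(\mathcal{H})$, a $C$-controlled continuous frame is a map $F:\Omega\to\mathcal{H}$, weakly measurable (i.e. $\omega\mapsto\langle f,F(\omega)\rangle$ is measurable for every $f\in\mathcal{H}$), for which there exist $m_{CL}>0$ and $M_{CL}<\infty$ such that $m_{CL}\|f\|^2\le\int_\Omega\langle f,F(\omega)\rangle\langle CF(\omega),f\rangle\,d\mu(\omega)\le M_{CL}\|f\|^2$ for all $f\in\mathcal{H}$. The continuous multiplier $\mathbf{M}_{m,F,G}:\mathcal{H}\to\mathcal{H}$ is the operator weakly defined by $\langle\mathbf{M}_{m,F,G}f,g\rangle=\int_\Omega m(\omega)\langle f,F(\omega)\rangle\langle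 G(\omega),g\rangle\,d\mu(\omega)$ for all $f,g\in\mathcal{H}$; "well defined" means that the integral exists for all $f,g$ and determines a bounded operator. *)

theory Defs
  imports "HOL-Analysis.Analysis"
begin

section \<open>Complex Hilbert spaces\<close>

class scaleC =
  fixes scaleC :: "complex \<Rightarrow> 'a \<Rightarrow> 'a"  (infixr "*\<^sub>C" 75)

class complex_vector = scaleC + real_vector +
  assumes scaleC_add_right: "a *\<^sub>C (x + y) = a *\<^sub>C x + a *\<^sub>C y"
    and scaleC_add_left: "(a + b) *\<^sub>C x = a *\<^sub>C x + b *\<^sub>C x"
    and scaleC_scaleC: "a *\<^sub>C (b *\<^sub>C x) = (a * b) *\<^sub>C x"
    and scaleC_one: "1 *\<^sub>C x = x"
    and scaleR_scaleC: "r *\<^sub>R x = complex_of_real r *\<^sub>C x"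

text \<open>The inner product is linear in the first and conjugate linear in the second argument.\<close>

class complex_inner = complex_vector + real_normed_vector +
  fixes cinner :: "'a \<Rightarrow> 'a \<Rightarrow> complex"
  assumes cinner_commute: "cinner x y = cnj (cinner y x)"
    and cinner_add_left: "cinner (x + y) z = cinner x z + cinner y z"
    and cinner_scaleC_left: "cinner (a *\<^sub>C x) y = a * cinner x y"
    and cinner_ge_zero: "0 \<le> Re (cinner x x)"
    and cinner_eq_zero_iff: "cinner x x = 0 \<longleftrightarrow> x = 0"
    and norm_eq_sqrt_cinner: "norm x = sqrt (Re (cinner x x))"

class complex_hilbert = complex_inner + complete_space

instantiation complex :: complex_hilbert
begin

definition scaleC_complex :: "complex \<Rightarrow> complex \<Rightarrow> complex"
  where "scaleC_complex a x = a * x"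

definition cinner_complex :: "complex \<Rightarrow> complex \<Rightarrow> complex"
  where "cinner_complex x y = x * cnj y"

instance
proof
  fix a b x y z :: complex and r :: real
  show "a *\<^sub>C (x + y) = a *\<^sub>C x + a *\<^sub>C y" "(a + b) *\<^sub>C x = a *\<^sub>C x + b *\<^sub>C x"
    "a *\<^sub>C (b *\<^sub>C x) = (a * b) *\<^sub>C x" "1 *\<^sub>C x = x"
    by (simp_all add: scaleC_complex_def distrib_left distrib_right)
  show "r *\<^sub>R x = complex_of_real r *\<^sub>C x"
    by (simp add: scaleC_complex_def scaleR_conv_of_real)
  show "cinner x y = cnj (cinner y x)" "cinner (x + y) z = cinner x z + cinner y z"
    "cinner (a *\<^sub>C x) y = a * cinner x y" "cinner x x = 0 \<longleftrightarrow> x = 0"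
    by (simp_all add: cinner_complex_def scaleC_complex_def distrib_right)
  show "0 \<le> Re (cinner x x)" "norm x = sqrt (Re (cinner x x))"
    by (simp_all add: cinner_complex_def cmod_def power2_eq_square)
qed

end


section \<open>Bounded operators\<close>

definition bounded_clinear :: "('h::complex_inner \<Rightarrow> 'h) \<Rightarrow> bool"
  where "bounded_clinear T \<longleftrightarrow>
    bounded_linear T \<and> (\<forall>a x. T (a *\<^sub>C x) = a *\<^sub>C T x)"

definition GL :: "('h::complex_inner \<Rightarrow> 'h) set"
  where "GL = {T. bounded_clinear T \<and> bij T \<and> bounded_clinear (inv T)}"

definition is_cadjoint :: "('h::complex_inner \<Rightarrow> 'h) \<Rightarrow> ('h \<Rightarrow> 'h) \<Rightarrow> bool"
  where "is_cadjoint S T \<longleftrightarrow> (\<forall>x y. cinner (S x) y = cinner x (T y))"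

definition selfadjoint :: "('h::complex_inner \<Rightarrow> 'h) \<Rightarrow> bool"
  where "selfadjoint T \<longleftrightarrow> is_cadjoint T T"


section \<open>Controlled continuous frames\<close>

text \<open>The space \<open>\<Omega>\<close> is \<open>space \<mu>\<close>; values of maps outside of it are irrelevant.\<close>

definition weakly_measurable :: "'w measure \<Rightarrow> ('w \<Rightarrow> 'h::complex_inner) \<Rightarrow> bool"
  where "weakly_measurable \<mu> F \<longleftrightarrow> (\<forall>f. (\<lambda>\<omega>. cinner f (F \<omega>)) \<in> borel_measurable \<mu>)"

text \<open>
  The integrand is complex-valued, so the two inequalities include the claim that the
  integral exists and is real.
\<close>

definition controlled_frame ::
    "'w measure \<Rightarrow> ('h::complex_hilbert \<Rightarrow> 'h) \<Rightarrow> ('w \<Rightarrow> 'h) \<Rightarrow> bool"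
  where "controlled_frame \<mu> C F \<longleftrightarrow>
    C \<in> GL \<and> weakly_measurable \<mu> F \<and>
    (\<exists>A B :: real. A > 0 \<and>
      (\<forall>f. \<exists>r :: real.
        has_bochner_integral \<mu> (\<lambda>\<omega>. cinner f (F \<omega>) * cinner (C (F \<omega>)) f) (complex_of_real r) \<and>
        A * (norm f)\<^sup>2 \<le> r \<and> r \<le> B * (norm f)\<^sup>2))"


section \<open>Continuous multipliers\<close>

definition is_multiplier ::
    "'w measure \<Rightarrow> ('w \<Rightarrow> complex) \<Rightarrow> ('w \<Rightarrow> 'h::complex_hilbert) \<Rightarrow> ('w \<Rightarrow> 'h) \<Rightarrow> ('h \<Rightarrow> 'h) \<Rightarrow> bool"
  where "is_multiplier \<mu> m F G T \<longleftrightarrow>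
    bounded_clinear T \<and>
    (\<forall>f g. has_bochner_integral \<mu>
      (\<lambda>\<omega>. m \<omega> * cinner f (F \<omega>) * cinner (G \<omega>) g) (cinner (T f) g))"

definition multiplier_well_defined ::
    "'w measure \<Rightarrow> ('w \<Rightarrow> complex) \<Rightarrow> ('w \<Rightarrow> 'h::complex_hilbert) \<Rightarrow> ('w \<Rightarrow> 'h) \<Rightarrow> bool"
  where "multiplier_well_defined \<mu> m F G \<longleftrightarrow> (\<exists>T. is_multiplier \<mu> m F G T)"

text \<open>Meaningful only if \<open>multiplier_well_defined\<close> holds; the operator is then unique.\<close>

definition multiplier ::
    "'w measure \<Rightarrow> ('w \<Rightarrow> complex) \<Rightarrow> ('w \<Rightarrow> 'h::complex_hilbert) \<Rightarrow> ('w \<Rightarrow> 'h) \<Rightarrow> 'h \<Rightarrow> 'h"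
  where "multiplier \<mu> m F G = (THE T. is_multiplier \<mu> m F G T)"

end

theory Submission
  imports Defs
begin

text \<open>
  Since \<open>\<langle>f, C (F \<omega>)\<rangle> = \<langle>C f, F \<omega>\<rangle>\<close> and
  \<open>\<langle>D (G \<omega>), g\<rangle> = \<langle>G \<omega>, D g\<rangle>\<close>, the weak integrand of the multiplier
  of the controlled frames at \<open>(f, g)\<close> is the one of \<open>M\<^sub>m\<^sub>,\<^sub>F\<^sub>,\<^sub>G\<close> at \<open>(C f, D g)\<close>.
  It therefore integrates to \<open>\<langle>M\<^sub>m\<^sub>,\<^sub>F\<^sub>,\<^sub>G (C f), D g\<rangle> = \<langle>D (M\<^sub>m\<^sub>,\<^sub>F\<^sub>,\<^sub>G (C f)), g\<rangle>\<close>,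
  so that the bounded operator \<open>D \<circ> M\<^sub>m\<^sub>,\<^sub>F\<^sub>,\<^sub>G \<circ> C\<close> is a multiplier of the controlled frames
  (\<open>is_multiplier_comp\<close>). A multiplier is determined by its weak integrals
  (\<open>is_multiplier_unique\<close>), and inverting \<open>C\<close> and \<open>D\<close> gives the claim.
\<close>

lemma cinner_diff_left:
  fixes x y z :: "'a::complex_inner"
  shows "cinner (x - y) z = cinner x z - cinner y z"
  using cinner_add_left[of "x - y" y z] by simp

lemma cinner_left_cancel:
  fixes x y :: "'a::complex_inner"
  assumes "\<And>z. cinner x z = cinner y z"
  shows "x = y"
proof -
  have "cinner (x - y) (x - y) = 0"
    by (simp add: cinner_diff_left assms)
  then show ?thesis
    by (simp add: cinner_eq_zero_iff)
qed

lemma bounded_clinear_comp: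
  assumes "bounded_clinear S" and "bounded_clinear T"
  shows "bounded_clinear (S \<circ> T)"
  using assms bounded_linear_compose[of S T] by (simp add: bounded_clinear_def comp_def)

text \<open>An operator is determined by its sesquilinear form, and a function has one Bochner integral.\<close>

lemma is_multiplier_unique:
  assumes "is_multiplier \<mu> m F G S" and "is_multiplier \<mu> m F G T"
  shows "S = T"
proof
  fix f
  have "cinner (S f) g = cinner (T f) g" for g
    using assms unfolding is_multiplier_def by (blast intro: has_bochner_integral_eq)
  then show "S f = T f"
    by (rule cinner_left_cancel)
qed

lemma multiplier_eqI: "is_multiplier \<mu> m F G T \<Longrightarrow> multiplier \<mu> m F G = T"
  unfolding multiplier_def by (blast intro: is_multiplier_unique)

text \<open>
  Operators applied pointwise to the two maps can be moved, through adjoints, onto the test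
  vectors \<open>f\<close> and \<open>g\<close>. As \<open>F\<close> enters in the conjugate linear argument,
  it is the adjoint of the right factor of the new operator that acts on it.
\<close>

lemma is_multiplier_comp:
  assumes T: "is_multiplier \<mu> m F G T"
    and R: "bounded_clinear R" "is_cadjoint R R'"
    and S: "bounded_clinear S" "is_cadjoint S S'"
  shows "is_multiplier \<mu> m (\<lambda>\<omega>. S' (F \<omega>)) (\<lambda>\<omega>. R (G \<omega>)) (R \<circ> T \<circ> S)"
  unfolding is_multiplier_def
proof (intro conjI allI)
  show "bounded_clinear (R \<circ> T \<circ> S)"
    using T R(1) S(1) by (simp add: is_multiplier_def bounded_clinear_comp)
next
  fix f g
  have "has_bochner_integral \<mu> (\<lambda>\<omega>. m \<omega> * cinner (S f) (F \<omega>) * cinner (G \<omega>) (R' g))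
      (cinner (T (S f)) (R' g))"
    using T by (simp add: is_multiplier_def)
  then show "has_bochner_integral \<mu> (\<lambda>\<omega>. m \<omega> * cinner f (S' (F \<omega>)) * cinner (R (G \<omega>)) g)
      (cinner ((R \<circ> T \<circ> S) f) g)"
    using R(2) S(2) by (simp add: is_cadjoint_def)
qed

theorem proposition4p3:
  fixes \<mu> :: "'w measure"
    and C D :: "'h::complex_hilbert \<Rightarrow> 'h"
    and F G :: "'w \<Rightarrow> 'h"
    and m :: "'w \<Rightarrow> complex"
  assumes "C \<in> GL" and "D \<in> GL"
    and "selfadjoint C" and "selfadjoint D"
    and "controlled_frame \<mu> C F" and "controlled_frame \<mu> D G"
    and "m \<in> borel_measurable \<mu>"
    and "multiplier_well_defined \<mu> m F G"
  shows "multiplier_well_defined \<mu> m (\<lambda>\<omega>. C (F \<omega>)) (\<lambda>\<omega>. D (G \<omega>)) \<and>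
    inv D \<circ> multiplier \<mu> m (\<lambda>\<omega>. C (F \<omega>)) (\<lambda>\<omega>. D (G \<omega>)) \<circ> inv C = multiplier \<mu> m F G"
proof -
  obtain T where T: "is_multiplier \<mu> m F G T"
    using assms(8) by (auto simp: multiplier_well_defined_def)
  have C: "bounded_clinear C" "bij C" and D: "bounded_clinear D" "bij D"
    using assms(1,2) by (auto simp: GL_def)
  have M: "is_multiplier \<mu> m (\<lambda>\<omega>. C (F \<omega>)) (\<lambda>\<omega>. D (G \<omega>)) (D \<circ> T \<circ> C)"
    using is_multiplier_comp[OF T D(1) _ C(1)] assms(3,4) by (simp add: selfadjoint_def)
  have "inv D \<circ> (D \<circ> T \<circ> C) \<circ> inv C = T"
    using C(2) D(2) by (simp add: fun_eq_iff bij_is_inj bij_is_surj surj_f_inv_f)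
  with M T show ?thesis
    by (auto simp: multiplier_well_defined_def multiplier_eqI)
qed

end
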